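(* Let $p$ be a prime number and let $P_2 = \mathbb{C}[x_1, x_2]$. There exists an uncountable set of subgroups of the group $\mathrm{Aut}\, P_2$ which are pairwise non-conjugate in $\mathrm{Aut}\, P_2$, each of which is isomorphic to the quasi-cyclic $p$-group $\mathbb{C}_{p^\infty}$, and none of which is conjugate in $\mathrm{Aut}\, P_2$ to a subgroup of linear automorphisms.
   Context: $P_2 = \mathbb{C}[x_1,x_2]$ is the polynomial algebra (with unit) in two commuting variables over the field $\mathbb{C}$ of complex numbers, and $\mathrm{Aut}\, P_2$ is the group of its $\mathbb{C}$-algebra automorphisms (automorphisms fixing every element of $\mathbb{C}$). A linear automorphism is one that sends each of $x_1, x_2$ to a homogeneous linear form in $x_1, x_2$; the linear automorphisms form a subgroup of $\mathrm{Aut}\, P_2$. The quasi-cyclic $p$-group $\mathbb{C}_{p^\infty}$ is the multiplicative group of all complex solutions of the equations $x^{p^n}=1$, $n=1,2,\ldots$. *)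

theory Defs
  imports
    Complex_Main
    "HOL-Library.Countable_Set"
    "HOL-Computational_Algebra.Polynomial"
    "HOL-Computational_Algebra.Primes"
    "HOL-Algebra.Coset"
begin

text \<open>
  The algebra \<open>P\<^sub>2 = \<complex>[x\<^sub>1, x\<^sub>2]\<close> is represented as \<open>\<complex>[x\<^sub>1][x\<^sub>2]\<close>: the inner polynomial
  variable is \<open>x\<^sub>1\<close> and the outer one is \<open>x\<^sub>2\<close>.
\<close>

type_synonym P2 = "complex poly poly"

definition P2_const :: "complex \<Rightarrow> P2" where
  "P2_const c = [:[:c:]:]"

definition X1 :: P2 where
  "X1 = [:[:0, 1:]:]"

definition X2 :: P2 where
  "X2 = [:0, 1:]"

definition P2_automorphism :: "(P2 \<Rightarrow> P2) \<Rightarrow> bool" where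
  "P2_automorphism \<phi> \<longleftrightarrow>
     bij \<phi> \<and>
     (\<forall>f g. \<phi> (f + g) = \<phi> f + \<phi> g) \<and>
     (\<forall>f g. \<phi> (f * g) = \<phi> f * \<phi> g) \<and>
     (\<forall>c. \<phi> (P2_const c) = P2_const c)"

definition Aut_P2 :: "(P2 \<Rightarrow> P2) monoid" where
  "Aut_P2 = \<lparr>carrier = {\<phi>. P2_automorphism \<phi>}, mult = (\<circ>), one = id\<rparr>"

lemma group_Aut_P2: "group Aut_P2"
proof (rule groupI)
  fix \<phi> assume "\<phi> \<in> carrier Aut_P2"
  then have \<phi>: "P2_automorphism \<phi>"
    by (simp add: Aut_P2_def)
  then have b: "bij \<phi>"
    by (simp add: P2_automorphism_def)
  have r: "\<phi> (inv_into UNIV \<phi> f) = f" and l: "inv_into UNIV \<phi> (\<phi> f) = f" for f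
    using b by (simp_all add: bij_is_surj bij_is_inj surj_f_inv_f)
  have "P2_automorphism (inv_into UNIV \<phi>)"
    unfolding P2_automorphism_def
  proof (intro conjI allI)
    show "bij (inv_into UNIV \<phi>)"
      using b by (rule bij_imp_bij_inv)
    show "inv_into UNIV \<phi> (f + g) = inv_into UNIV \<phi> f + inv_into UNIV \<phi> g" for f g
      using \<phi> l r by (metis P2_automorphism_def)
    show "inv_into UNIV \<phi> (f * g) = inv_into UNIV \<phi> f * inv_into UNIV \<phi> g" for f g
      using \<phi> l r by (metis P2_automorphism_def)
    show "inv_into UNIV \<phi> (P2_const c) = P2_const c" for c
      using \<phi> l by (metis P2_automorphism_def)
  qed
  moreover have "inv_into UNIV \<phi> \<circ> \<phi> = id"
    using l by auto
  ultimately show "\<exists>\<psi>\<in>carrier Aut_P2. \<psi> \<otimes>\<^bsub>Aut_P2\<^esub> \<phi> = \<one>\<^bsub>Aut_P2\<^esub>"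
    by (auto simp: Aut_P2_def)
qed (auto simp: Aut_P2_def P2_automorphism_def bij_comp comp_assoc)

definition P2_linear_form :: "P2 \<Rightarrow> bool" where
  "P2_linear_form f \<longleftrightarrow> (\<exists>a b. f = P2_const a * X1 + P2_const b * X2)"

definition linear_Aut_P2 :: "(P2 \<Rightarrow> P2) set" where
  "linear_Aut_P2 =
     {\<phi> \<in> carrier Aut_P2. P2_linear_form (\<phi> X1) \<and> P2_linear_form (\<phi> X2)}"

definition conjugate_in :: "('a, 'b) monoid_scheme \<Rightarrow> 'a set \<Rightarrow> 'a set \<Rightarrow> bool" where
  "conjugate_in G H K \<longleftrightarrow>
     (\<exists>g\<in>carrier G. K = (g <#\<^bsub>G\<^esub> H) #>\<^bsub>G\<^esub> inv\<^bsub>G\<^esub> g)"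

definition quasi_cyclic_group :: "nat \<Rightarrow> complex monoid" where
  "quasi_cyclic_group p =
     \<lparr>carrier = {z. \<exists>n\<ge>1. z ^ (p ^ n) = 1}, mult = (*), one = 1\<rparr>"

end

theory Submission
  imports Defs
begin

text \<open>
  Fix a set \<open>S\<close> of natural numbers and put \<open>g\<^sub>S = \<Sum>n\<in>S. x\<^sub>1 ^ (1 + p ^ n)\<close>, a power series that is
  not a polynomial when \<open>S\<close> is infinite. Conjugating the scalar maps \<open>x\<^sub>i \<mapsto> z x\<^sub>i\<close> with
  \<open>z \<in> \<complex>\<^bsub>p^\<infinity>\<^esub>\<close> by the formal shear \<open>x\<^sub>2 \<mapsto> x\<^sub>2 + g\<^sub>S(x\<^sub>1)\<close> gives the maps
  \<open>x\<^sub>1 \<mapsto> z x\<^sub>1\<close>, \<open>x\<^sub>2 \<mapsto> z x\<^sub>2 + z g\<^sub>S(x\<^sub>1) - g\<^sub>S(z x\<^sub>1)\<close>. If \<open>z\<close> has order dividing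
  \<open>p ^ N\<close> then \<open>z ^ (1 + p ^ n) = z\<close> for every \<open>n \<ge> N\<close>, so only the terms of \<open>g\<^sub>S\<close> with \<open>n < N\<close>
  survive and the result is a polynomial automorphism. Thus each \<open>S\<close> yields a subgroup
  \<open>H\<^sub>S\<close> of \<open>Aut P\<^sub>2\<close> isomorphic to the quasi-cyclic group: each of its finite subgroups is
  conjugate to a group of scalars in \<open>Aut P\<^sub>2\<close>, and \<open>H\<^sub>S\<close> itself is so formally.

  Suppose that \<open>\<phi>\<close> conjugates \<open>H\<^sub>S\<close> to \<open>H\<^sub>T\<close>. As a map of the plane it fixes the origin, the only
  common fixed point of each of the two groups. Undoing both formal shears turns \<open>\<phi>\<close> into a formal
  automorphism that normalizes the group of scalars of \<open>p\<close>-power order. Its linear part at the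
  origin is invertible and commutes with scalars, so it does not permute them; hence the formal
  automorphism commutes with all these scalars, and it is therefore linear, because for
  \<open>d \<noteq> 1\<close> one of them has \<open>z ^ d \<noteq> z\<close>. So \<open>\<phi>\<close> is a linear map between two formal shears. If \<open>T\<close>
  is infinite, polynomiality of \<open>\<phi> x\<^sub>1\<close> forces the linear map to be triangular, and
  polynomiality of \<open>\<phi> x\<^sub>2\<close> then says that \<open>a g\<^sub>T(x\<^sub>1) - g\<^sub>S(d x\<^sub>1)\<close> is a polynomial for some
  nonzero \<open>a\<close> and \<open>d\<close>. Hence \<open>S\<close> and \<open>T\<close> differ in finitely many elements only. A group of linear
  automorphisms in place of \<open>H\<^sub>S\<close> is treated in the same way, as if \<open>S = {}\<close>, since the
  argument with linear parts shows that it consists of scalars; then \<open>T\<close> would be finite.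
  An uncountable family of infinite sets with pairwise infinite symmetric differences
  therefore gives the required family of subgroups.

  In the proof below truncations take the place of power series: for every \<open>N > 0\<close> the sums
  \<open>g\<^sub>S\<close> and \<open>g\<^sub>T\<close> are cut off at a level \<open>M \<ge> N\<close>, a primitive root of unity of order \<open>p ^ N\<close> is
  used, and equalities hold up to terms of degree greater than \<open>p ^ N\<close>. The two main steps are \<open>conjugator_mod_high_order\<close>, the
  linearity of the conjugated \<open>\<phi>\<close> up to high degree, and \<open>conjugate_gap_sets\<close>, the comparison of
  coefficients.
\<close>

section \<open>Coefficients and automorphisms\<close>

lemma P2_const_0 [simp]: "P2_const 0 = 0" and P2_const_1 [simp]: "P2_const 1 = 1"
  by (simp_all add: P2_const_def one_pCons)

definition cf :: "P2 \<Rightarrow> nat \<Rightarrow> nat \<Rightarrow> complex" where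
  "cf f i j = coeff (coeff f j) i"

lemma P2_eqI: "(\<And>i j. cf f i j = cf g i j) \<Longrightarrow> f = g"
  by (simp add: cf_def poly_eq_iff)

lemma cf_add [simp]: "cf (f + g) i j = cf f i j + cf g i j"
  and cf_diff [simp]: "cf (f - g) i j = cf f i j - cf g i j"
  and cf_zero [simp]: "cf 0 i j = 0"
  and cf_const_mult [simp]: "cf (P2_const c * f) i j = c * cf f i j"
  by (simp_all add: cf_def P2_const_def)

lemma cf_X1 [simp]: "cf X1 i j = (if i = 1 \<and> j = 0 then 1 else 0)"
  and cf_X2 [simp]: "cf X2 i j = (if i = 0 \<and> j = 1 then 1 else 0)"
  and cf_inner [simp]: "cf [:q:] i j = (if j = 0 then coeff q i else 0)"
  by (auto simp: cf_def X1_def X2_def coeff_pCons split: nat.splits)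

lemma cf_const [simp]: "cf (P2_const c) i j = (if i = 0 \<and> j = 0 then c else 0)"
  by (auto simp: P2_const_def coeff_pCons split: nat.splits)

text \<open>
  Two algebra maps can be compared through their values on the generators, and estimates for
  the images of the generators pass to all polynomials, because of this expansion.
\<close>

lemma P2_monomial_expansion:
  "f = (\<Sum>j\<le>degree f. \<Sum>i\<le>degree (coeff f j). P2_const (cf f i j) * X1 ^ i * X2 ^ j)"
proof -
  have inner: "[:q:] = (\<Sum>i\<le>degree q. P2_const (coeff q i) * X1 ^ i)" for q :: "complex poly"
  proof -
    have pw: "X1 ^ i = [:[:0, 1:] ^ i:]" for i
      by (simp add: X1_def pCons_one poly_const_pow)
    have sm: "(\<Sum>i\<in>A. [:h i:]) = [:sum h A:]" for h :: "nat \<Rightarrow> complex poly" and A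
      by (induction A rule: infinite_finite_induct) auto
    have "(\<Sum>i\<le>degree q. P2_const (coeff q i) * X1 ^ i) = (\<Sum>i\<le>degree q. [:monom (coeff q i) i:])"
      by (intro sum.cong) (simp_all add: pw P2_const_def monom_altdef)
    then show ?thesis
      by (simp add: sm poly_as_sum_of_monoms)
  qed
  have "f = (\<Sum>j\<le>degree f. monom (coeff f j) j)"
    by (simp add: poly_as_sum_of_monoms)
  also have "\<dots> = (\<Sum>j\<le>degree f. [:coeff f j:] * X2 ^ j)"
    by (simp add: monom_altdef X2_def)
  also have "\<dots> = (\<Sum>j\<le>degree f. \<Sum>i\<le>degree (coeff f j). P2_const (cf f i j) * X1 ^ i * X2 ^ j)"
    by (subst inner) (simp add: sum_distrib_right cf_def)
  finally show ?thesis .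
qed

context
  fixes \<phi> assumes \<phi>: "P2_automorphism \<phi>"
begin

lemma aut_add: "\<phi> (f + g) = \<phi> f + \<phi> g"
  and aut_mult: "\<phi> (f * g) = \<phi> f * \<phi> g"
  and aut_const: "\<phi> (P2_const c) = P2_const c"
  using \<phi> by (simp_all add: P2_automorphism_def)

lemma aut_0: "\<phi> 0 = 0"
  using aut_const[of 0] by simp

lemma aut_sum: "\<phi> (sum h A) = (\<Sum>x\<in>A. \<phi> (h x))"
  by (induction A rule: infinite_finite_induct) (simp_all add: aut_0 aut_add)

lemma aut_power: "\<phi> (f ^ n) = \<phi> f ^ n"
  using aut_const[of 1] by (induction n) (simp_all add: aut_mult)

lemma aut_expansion:
  "\<phi> f = (\<Sum>j\<le>degree f. \<Sum>i\<le>degree (coeff f j). P2_const (cf f i j) * \<phi> X1 ^ i * \<phi> X2 ^ j)"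
  by (subst (1) P2_monomial_expansion) (simp add: aut_sum aut_mult aut_power aut_const)

lemma aut_inner: "\<phi> X1 = P2_const d * X1 \<Longrightarrow> \<phi> [:q:] = [:q \<circ>\<^sub>p [:0, d:]:]"
proof (induction q)
  case 0
  then show ?case by (simp add: aut_0)
next
  case (pCons a q)
  have "[:pCons a q:] = P2_const a + X1 * [:q:]"
    by (simp add: P2_const_def X1_def)
  then have "\<phi> [:pCons a q:] = P2_const a + P2_const d * X1 * [:q \<circ>\<^sub>p [:0, d:]:]"
    using pCons by (simp only: aut_add aut_mult aut_const)
  then show ?case
    by (simp add: pcompose_pCons) (simp add: P2_const_def X1_def)
qed

end

lemma aut_eqI:
  assumes "P2_automorphism \<phi>" "P2_automorphism \<psi>" "\<phi> X1 = \<psi> X1" "\<phi> X2 = \<psi> X2"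
  shows "\<phi> = \<psi>"
proof
  show "\<phi> f = \<psi> f" for f
    using aut_expansion[OF assms(1), of f] aut_expansion[OF assms(2), of f] assms(3,4) by simp
qed

lemma aut_comp: "P2_automorphism \<phi> \<Longrightarrow> P2_automorphism \<psi> \<Longrightarrow> P2_automorphism (\<phi> \<circ> \<psi>)"
  by (auto simp: P2_automorphism_def bij_comp)

lemma aut_inverse_exists:
  assumes "P2_automorphism \<phi>"
  obtains \<psi> where "P2_automorphism \<psi>" "\<phi> \<circ> \<psi> = id" "\<psi> \<circ> \<phi> = id"
proof -
  have "\<phi> \<in> Units Aut_P2"
    using assms by (simp add: group.Units_eq[OF group_Aut_P2]) (simp add: Aut_P2_def)
  then show ?thesis
    using that by (auto simp: Units_def Aut_P2_def)
qed

lemma conjugate_in_Aut_P2: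
  assumes "conjugate_in Aut_P2 H K"
  obtains \<phi> \<psi> where "P2_automorphism \<phi>" "P2_automorphism \<psi>" "\<phi> \<circ> \<psi> = id" "\<psi> \<circ> \<phi> = id"
    "K = (\<lambda>h. \<phi> \<circ> h \<circ> \<psi>) ` H"
proof -
  interpret A: group Aut_P2 by (rule group_Aut_P2)
  obtain g where g: "g \<in> carrier Aut_P2" "K = (g <#\<^bsub>Aut_P2\<^esub> H) #>\<^bsub>Aut_P2\<^esub> inv\<^bsub>Aut_P2\<^esub> g"
    using assms by (auto simp: conjugate_in_def)
  have "g \<circ> inv\<^bsub>Aut_P2\<^esub> g = id" "inv\<^bsub>Aut_P2\<^esub> g \<circ> g = id"
    using A.r_inv[OF g(1)] A.l_inv[OF g(1)] by (simp_all add: Aut_P2_def)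
  moreover have "K = (\<lambda>h. g \<circ> h \<circ> inv\<^bsub>Aut_P2\<^esub> g) ` H"
    unfolding g(2) l_coset_def r_coset_def by (auto simp: Aut_P2_def)
  ultimately show ?thesis
    using that[of g "inv\<^bsub>Aut_P2\<^esub> g"] g(1) A.inv_closed[OF g(1)] by (simp add: Aut_P2_def)
qed

section \<open>Shears and scalar maps\<close>

definition shear :: "complex poly \<Rightarrow> P2 \<Rightarrow> P2" where
  "shear h f = f \<circ>\<^sub>p [:h, 1:]"

lemma shear_0 [simp]: "shear 0 = id"
  by (auto simp: shear_def fun_eq_iff pcompose_idR)

lemma shear_comp: "shear g \<circ> shear h = shear (g + h)"
  by (auto simp: shear_def fun_eq_iff pcompose_pCons add.commute simp flip: pcompose_assoc)

lemma shear_uminus [simp]: "shear h \<circ> shear (- h) = id" "shear (- h) \<circ> shear h = id"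
  by (simp_all add: shear_comp)

lemma aut_shear: "P2_automorphism (shear h)"
  unfolding P2_automorphism_def
proof (intro conjI allI)
  show "bij (shear h)"
    using o_bij[of "shear (- h)" "shear h"] by simp
qed (simp_all add: shear_def pcompose_add pcompose_mult P2_const_def)

lemma shear_X1 [simp]: "shear h X1 = X1" and shear_X2 [simp]: "shear h X2 = X2 + [:h:]"
  by (simp_all add: shear_def X1_def X2_def pcompose_pCons)

definition scale :: "complex \<Rightarrow> P2 \<Rightarrow> P2" where
  "scale z f = map_poly (\<lambda>q. q \<circ>\<^sub>p [:0, z:]) f \<circ>\<^sub>p [:0, [:z:]:]"

lemma coeff_scale: "coeff (scale z f) j = [:z:] ^ j * (coeff f j \<circ>\<^sub>p [:0, z:])"
  by (simp add: scale_def coeff_pcompose_linear coeff_map_poly)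

lemma cf_scale: "cf (scale z f) i j = z ^ (i + j) * cf f i j"
  by (simp add: cf_def coeff_scale poly_const_pow coeff_pcompose_linear power_add)

lemma scale_comp: "scale z \<circ> scale w = scale (z * w)"
  by (intro ext P2_eqI) (simp add: cf_scale power_mult_distrib)

lemma scale_1 [simp]: "scale 1 = id"
  by (intro ext P2_eqI) (simp add: cf_scale)

lemma aut_scale:
  assumes "z \<noteq> 0"
  shows "P2_automorphism (scale z)"
  unfolding P2_automorphism_def
proof (intro conjI allI)
  show "bij (scale z)"
    using o_bij[of "scale (inverse z)" "scale z"] assms by (simp add: scale_comp)
  show "scale z (f + g) = scale z f + scale z g" for f g
    by (intro P2_eqI) (simp add: cf_scale algebra_simps)
  show "scale z (f * g) = scale z f * scale z g" for f g
  proof (rule poly_eqI)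
    fix n
    have "[:z:] ^ n * (a * b) = [:z:] ^ k * a * ([:z:] ^ (n - k) * b)" if "k \<le> n" for k a b
    proof -
      have "[:z:] ^ n = [:z:] ^ k * [:z:] ^ (n - k)"
        using that by (simp flip: power_add)
      then show ?thesis by (simp only: mult_ac)
    qed
    then show "coeff (scale z (f * g)) n = coeff (scale z f * scale z g) n"
      unfolding coeff_mult coeff_scale pcompose_sum pcompose_mult sum_distrib_left
      by (intro sum.cong refl) blast
  qed
  show "scale z (P2_const c) = P2_const c" for c
    by (intro P2_eqI) (simp add: cf_scale)
qed

lemma scale_X1: "scale z X1 = P2_const z * X1" and scale_X2: "scale z X2 = P2_const z * X2"
  by (auto intro!: P2_eqI simp: cf_scale)

text \<open>
  The condition on \<open>r\<close> holds when every exponent \<open>e\<close> in \<open>r\<close> satisfies \<open>z ^ e = z\<close>. It is the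
  reason why high terms of the gap series do not matter for roots of unity of small order.
\<close>

lemma scale_shear_commute:
  assumes "z \<noteq> 0" "r \<circ>\<^sub>p [:0, z:] = smult z r"
  shows "scale z \<circ> shear r = shear r \<circ> scale z"
proof (rule aut_eqI)
  have "scale z [:r:] = P2_const z * [:r:]"
    using aut_inner[OF aut_scale[OF assms(1)] scale_X1] assms(2) by (simp add: P2_const_def)
  then show "(scale z \<circ> shear r) X2 = (shear r \<circ> scale z) X2"
    by (simp add: aut_add[OF aut_scale[OF assms(1)]] scale_X2 aut_mult[OF aut_shear]
        aut_const[OF aut_shear] distrib_left)
qed (simp_all add: aut_comp aut_scale aut_shear assms(1) scale_X1 aut_mult[OF aut_shear]
        aut_const[OF aut_shear])

section \<open>Order of vanishing and linear parts at the origin\<close>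

definition order_ge :: "nat \<Rightarrow> P2 \<Rightarrow> bool" where
  "order_ge m f \<longleftrightarrow> (\<forall>i j. i + j < m \<longrightarrow> cf f i j = 0)"

lemma order_ge_mono: "order_ge m f \<Longrightarrow> n \<le> m \<Longrightarrow> order_ge n f"
  by (simp add: order_ge_def)

lemma order_ge_mult:
  assumes "order_ge m f" "order_ge n g"
  shows "order_ge (m + n) (f * g)"
  unfolding order_ge_def
proof (intro allI impI)
  fix i j assume ij: "i + j < m + n"
  have "cf (f * g) i j = (\<Sum>k\<le>j. \<Sum>l\<le>i. cf f l k * cf g (i - l) (j - k))"
    by (simp add: cf_def coeff_mult coeff_sum)
  also have "\<dots> = 0"
  proof (intro sum.neutral ballI)
    fix k l assume "k \<in> {..j}" "l \<in> {..i}"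
    then have "l + k < m \<or> (i - l) + (j - k) < n"
      using ij by simp arith
    then show "cf f l k * cf g (i - l) (j - k) = 0"
      using assms by (auto simp: order_ge_def)
  qed
  finally show "cf (f * g) i j = 0" .
qed

lemma order_ge_power: "order_ge 1 f \<Longrightarrow> order_ge n (f ^ n)"
  by (induction n) (auto simp: order_ge_def[of 0] dest: order_ge_mult)

lemma order_ge_sum: "(\<And>x. x \<in> A \<Longrightarrow> order_ge m (h x)) \<Longrightarrow> order_ge m (sum h A)"
  by (induction A rule: infinite_finite_induct) (simp_all add: order_ge_def)

text \<open>
  An automorphism \<open>\<phi>\<close> is substitution of \<open>(\<phi> X1, \<phi> X2)\<close>; seen as a polynomial map of the plane
  it fixes the origin exactly when these two have no constant term.
\<close>

definition fixes_origin :: "(P2 \<Rightarrow> P2) \<Rightarrow> bool" where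
  "fixes_origin \<phi> \<longleftrightarrow> cf (\<phi> X1) 0 0 = 0 \<and> cf (\<phi> X2) 0 0 = 0"

lemma aut_order_ge:
  assumes "P2_automorphism \<phi>" "fixes_origin \<phi>" "order_ge m f"
  shows "order_ge m (\<phi> f)"
proof -
  have "order_ge m (P2_const (cf f i j) * \<phi> X1 ^ i * \<phi> X2 ^ j)" for i j
  proof (cases "i + j < m")
    case True
    then show ?thesis using assms(3) by (simp add: order_ge_def)
  next
    case False
    have "order_ge 1 (\<phi> X1)" "order_ge 1 (\<phi> X2)"
      using assms(2) by (auto simp: fixes_origin_def order_ge_def)
    then have "order_ge (0 + i + j) (P2_const (cf f i j) * \<phi> X1 ^ i * \<phi> X2 ^ j)"
      by (intro order_ge_mult order_ge_power) (simp_all add: order_ge_def)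
    then show ?thesis using False by (elim order_ge_mono) simp
  qed
  then show ?thesis
    by (subst aut_expansion[OF assms(1)]) (intro order_ge_sum)
qed

lemma aut_cf_0_0:
  assumes "P2_automorphism \<phi>" "fixes_origin \<phi>"
  shows "cf (\<phi> f) 0 0 = cf f 0 0"
proof -
  have "order_ge 1 (f - P2_const (cf f 0 0))"
    by (simp add: order_ge_def)
  then have "order_ge 1 (\<phi> (f - P2_const (cf f 0 0)))"
    by (rule aut_order_ge[OF assms])
  moreover have "\<phi> f = \<phi> (f - P2_const (cf f 0 0)) + P2_const (cf f 0 0)"
    using aut_add[OF assms(1), of "f - P2_const (cf f 0 0)" "P2_const (cf f 0 0)"]
    by (simp add: aut_const[OF assms(1)])
  ultimately show ?thesis by (simp add: order_ge_def)
qed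

text \<open>
  With \<open>m = 2\<close> this gives the chain rule below; for large \<open>m\<close> it carries the linearity of a
  conjugated automorphism through a shear.
\<close>

lemma aut_near_linear:
  assumes "P2_automorphism \<phi>" "fixes_origin \<phi>"
    and "order_ge m (f - (P2_const d * X1 + P2_const c * X2))"
  shows "order_ge m (\<phi> f - (P2_const d * \<phi> X1 + P2_const c * \<phi> X2))"
proof -
  let ?R = "f - (P2_const d * X1 + P2_const c * X2)"
  have "\<phi> f = \<phi> (P2_const d * X1 + P2_const c * X2 + ?R)" by simp
  also have "\<dots> = P2_const d * \<phi> X1 + P2_const c * \<phi> X2 + \<phi> ?R"
    by (simp only: aut_add[OF assms(1)] aut_mult[OF assms(1)] aut_const[OF assms(1)])
  finally show ?thesis using aut_order_ge[OF assms] by simp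
qed

text \<open>
  The chain rule at the origin.
\<close>

lemma aut_linear_part:
  assumes "P2_automorphism \<phi>" "fixes_origin \<phi>" "cf f 0 0 = 0" "i + j = 1"
  shows "cf (\<phi> f) i j = cf f 1 0 * cf (\<phi> X1) i j + cf f 0 1 * cf (\<phi> X2) i j"
proof -
  have "order_ge 2 (f - (P2_const (cf f 1 0) * X1 + P2_const (cf f 0 1) * X2))"
    unfolding order_ge_def
  proof (intro allI impI)
    fix i j :: nat assume "i + j < 2"
    then have "(i, j) = (0, 0) \<or> (i, j) = (1, 0) \<or> (i, j) = (0, 1)" by auto
    then show "cf (f - (P2_const (cf f 1 0) * X1 + P2_const (cf f 0 1) * X2)) i j = 0"
      using assms(3) by auto
  qed
  from aut_near_linear[OF assms(1,2) this] show ?thesis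
    using assms(4) by (simp add: order_ge_def)
qed

text \<open>
  By the chain rule the Jacobian matrices of \<open>\<phi>\<close> and of its inverse at the origin are inverse
  to each other.
\<close>

lemma aut_jacobian_nonzero:
  assumes "P2_automorphism \<phi>" "P2_automorphism \<psi>" "\<phi> \<circ> \<psi> = id" "fixes_origin \<phi>"
  shows "cf (\<phi> X1) 1 0 * cf (\<phi> X2) 0 1 - cf (\<phi> X1) 0 1 * cf (\<phi> X2) 1 0 \<noteq> 0"
proof -
  have inv: "\<phi> (\<psi> f) = f" for f
    using fun_cong[OF assms(3), of f] by simp
  have z: "cf (\<psi> X1) 0 0 = 0" "cf (\<psi> X2) 0 0 = 0"
    using aut_cf_0_0[OF assms(1,4), of "\<psi> X1"] aut_cf_0_0[OF assms(1,4), of "\<psi> X2"]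
    by (simp_all add: inv)
  note l1 = aut_linear_part[OF assms(1,4) z(1), unfolded inv]
  note l2 = aut_linear_part[OF assms(1,4) z(2), unfolded inv]
  have "a * d - b * c \<noteq> 0"
    if "1 = p * a + q * c" "0 = p * b + q * d" "0 = r * a + s * c" "1 = r * b + s * d"
    for a b c d p q r s :: complex
  proof -
    have "(p * s - q * r) * (a * d - b * c) = (p * a + q * c) * (r * b + s * d) - (p * b + q * d) * (r * a + s * c)"
      by (simp add: algebra_simps)
    also have "\<dots> = 1" by (simp flip: that)
    finally show ?thesis by auto
  qed
  then show ?thesis
    using l1[of 1 0] l1[of 0 1] l2[of 1 0] l2[of 0 1] by simp
qed

text \<open>
  Both components of \<open>\<theta>\<close> are eigenvectors of \<open>l\<close> for the eigenvalue \<open>z\<close>. Since \<open>l\<close> respects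
  degrees, so are their constant terms, which vanish because of \<open>z \<noteq> 1\<close>, and their linear parts,
  which span all linear forms because the Jacobian of \<open>\<theta>\<close> is nonzero. The fixed point at the
  origin is thus a consequence of the conjugacy, and a linear \<open>l\<close> conjugate to a scalar
  other than \<open>1\<close> is that scalar.
\<close>

lemma linear_conjugate_scale:
  assumes "P2_automorphism \<theta>" "P2_automorphism \<psi>" "\<theta> \<circ> \<psi> = id"
    and "l \<in> linear_Aut_P2" "z \<noteq> 0" "z \<noteq> 1" "l \<circ> \<theta> = \<theta> \<circ> scale z"
  shows "l = scale z" "fixes_origin \<theta>"
proof -
  have l: "P2_automorphism l"
    using assms(4) by (simp add: linear_Aut_P2_def Aut_P2_def)
  obtain u v u' v' where lX: "l X1 = P2_const u * X1 + P2_const v * X2"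
    "l X2 = P2_const u' * X1 + P2_const v' * X2"
    using assms(4) by (auto simp: linear_Aut_P2_def P2_linear_form_def)
  have l0: "fixes_origin l"
    by (simp add: fixes_origin_def lX)
  have e: "l (\<theta> X1) = P2_const z * \<theta> X1" "l (\<theta> X2) = P2_const z * \<theta> X2"
    using fun_cong[OF assms(7), of X1] fun_cong[OF assms(7), of X2]
    by (simp_all add: scale_X1 scale_X2 aut_mult[OF assms(1)] aut_const[OF assms(1)])
  show o: "fixes_origin \<theta>"
    using aut_cf_0_0[OF l l0, of "\<theta> X1"] aut_cf_0_0[OF l l0, of "\<theta> X2"] e assms(6)
    by (simp add: fixes_origin_def)
  note det = aut_jacobian_nonzero[OF assms(1-3) o]
  have z: "cf (\<theta> X1) 0 0 = 0" "cf (\<theta> X2) 0 0 = 0"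
    using o by (auto simp: fixes_origin_def)
  note l1 = aut_linear_part[OF l l0 z(1), unfolded e]
  note l2 = aut_linear_part[OF l l0 z(2), unfolded e]
  have cramer: "x = z \<and> y = 0"
    if "a * d - b * c \<noteq> 0" "z * a = a * x + b * y" "z * c = c * x + d * y"
    for a b c d x y :: complex
  proof -
    have "(a * d - b * c) * (x - z) = d * (a * x + b * y - z * a) - b * (c * x + d * y - z * c)"
      "(a * d - b * c) * y = a * (c * x + d * y - z * c) - c * (a * x + b * y - z * a)"
      by (simp_all add: algebra_simps)
    then show ?thesis using that by simp
  qed
  have "u = z \<and> u' = 0"
    using l1[of 1 0] l2[of 1 0] by (intro cramer[OF det]) (simp_all add: lX)
  moreover have "v' = z \<and> v = 0"
  proof (rule cramer)
    show "cf (\<theta> X1) 0 1 * cf (\<theta> X2) 1 0 - cf (\<theta> X1) 1 0 * cf (\<theta> X2) 0 1 \<noteq> 0"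
      using det by simp
  qed (use l1[of 0 1] l2[of 0 1] in \<open>simp_all add: lX\<close>)
  ultimately show "l = scale z"
    by (intro aut_eqI l aut_scale assms(5)) (simp_all add: lX scale_X1 scale_X2)
qed

lemma fixes_origin_shear: "coeff h 0 = 0 \<Longrightarrow> fixes_origin (shear h)"
  by (simp add: fixes_origin_def)

text \<open>
  Scaling multiplies a monomial of degree \<open>d\<close> by \<open>z ^ d\<close>, so an eigenvector for the eigenvalue \<open>z\<close>
  has only monomials of degrees \<open>d\<close> with \<open>z ^ d = z\<close>, which excludes \<open>2 \<le> d \<le> m\<close>.
\<close>

lemma scale_commuting_near_linear:
  assumes "scale z g = P2_const z * g" "cf g 0 0 = 0" "z \<noteq> 0"
    and "\<And>k. 0 < k \<Longrightarrow> k < m \<Longrightarrow> z ^ k \<noteq> 1"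
  shows "order_ge (Suc m) (g - (P2_const (cf g 1 0) * X1 + P2_const (cf g 0 1) * X2))"
  unfolding order_ge_def
proof (intro allI impI)
  fix i j assume ij: "i + j < Suc m"
  have "cf g i j = 0" if "i + j \<noteq> 1"
  proof (cases "i + j = 0")
    case False
    then have "z ^ (i + j - 1) \<noteq> 1"
      using that ij by (intro assms(4)) auto
    moreover have "z ^ (i + j) = z * z ^ (i + j - 1)"
      using False by (simp flip: power_Suc)
    moreover have "z ^ (i + j) * cf g i j = z * cf g i j"
      using arg_cong[OF assms(1), of "\<lambda>f. cf f i j"] by (simp add: cf_scale)
    ultimately show ?thesis
      using assms(3) by auto
  qed (use assms(2) in simp)
  moreover have "i + j = 1 \<longleftrightarrow> (i = 1 \<and> j = 0) \<or> (i = 0 \<and> j = 1)" by auto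
  ultimately show "cf (g - (P2_const (cf g 1 0) * X1 + P2_const (cf g 0 1) * X2)) i j = 0"
    by auto
qed

section \<open>The twisted quasi-cyclic groups\<close>

text \<open>
  The truncations of the power series \<open>\<Sum>n\<in>S. x\<^sub>1 ^ (1 + p ^ n)\<close>. With these exponents every scalar
  of \<open>p\<close>-power order commutes with the shears by all but finitely many of its terms.
\<close>

definition gap_poly :: "nat \<Rightarrow> nat set \<Rightarrow> nat \<Rightarrow> complex poly" where
  "gap_poly p S N = (\<Sum>n\<in>S \<inter> {..<N}. monom 1 (Suc (p ^ n)))"

lemma coeff_gap_poly:
  assumes "p \<ge> 2"
  shows "coeff (gap_poly p S N) i = (if \<exists>n\<in>S. n < N \<and> i = Suc (p ^ n) then 1 else 0)"
proof -
  have *: "coeff (gap_poly p S N) i = (\<Sum>n\<in>S \<inter> {..<N}. if Suc (p ^ n) = i then 1 else 0)"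
    by (simp add: gap_poly_def coeff_sum)
  show ?thesis
  proof (cases "\<exists>n\<in>S. n < N \<and> i = Suc (p ^ n)")
    case True
    then obtain n where n: "n \<in> S" "n < N" "i = Suc (p ^ n)" by auto
    then have "(Suc (p ^ m) = i) = (m = n)" for m
      using assms by simp
    then have "coeff (gap_poly p S N) i = 1"
      unfolding * using n by simp
    then show ?thesis using True by simp
  next
    case False
    then show ?thesis by (auto simp: * intro!: sum.neutral)
  qed
qed

lemma coeff_gap_poly_low: "p \<ge> 2 \<Longrightarrow> i < 2 \<Longrightarrow> coeff (gap_poly p S N) i = 0"
  by (auto simp: coeff_gap_poly)

lemma coeff_gap_poly_exponent:
  "p \<ge> 2 \<Longrightarrow> n < N \<Longrightarrow> coeff (gap_poly p S N) (Suc (p ^ n)) = of_bool (n \<in> S)"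
  by (auto simp: coeff_gap_poly)

lemma finite_gap_coefficients:
  assumes "p \<ge> 2"
  shows "finite {n. cf f (Suc (p ^ n)) 0 \<noteq> 0}"
proof (rule finite_subset)
  show "{n. cf f (Suc (p ^ n)) 0 \<noteq> 0} \<subseteq> {..degree (coeff f 0)}"
  proof clarify
    fix n assume "cf f (Suc (p ^ n)) 0 \<noteq> 0"
    then have "Suc (p ^ n) \<le> degree (coeff f 0)"
      unfolding cf_def by (rule le_degree)
    then show "n \<le> degree (coeff f 0)"
      using power_gt_expt[of p n] assms by simp
  qed
qed simp

text \<open>
  The scalar \<open>z\<close> conjugated by the truncated formal shear, and its stable value for large
  truncation levels. Any level \<open>N\<close> with \<open>z ^ (p ^ N) = 1\<close> gives this value; the least one only
  serves to make a choice.
\<close>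

definition twist :: "nat \<Rightarrow> nat set \<Rightarrow> nat \<Rightarrow> complex \<Rightarrow> P2 \<Rightarrow> P2" where
  "twist p S N z = shear (gap_poly p S N) \<circ> scale z \<circ> shear (- gap_poly p S N)"

definition twisted :: "nat \<Rightarrow> nat set \<Rightarrow> complex \<Rightarrow> P2 \<Rightarrow> P2" where
  "twisted p S z = twist p S (LEAST N. z ^ (p ^ N) = 1) z"

definition twisted_group :: "nat \<Rightarrow> nat set \<Rightarrow> (P2 \<Rightarrow> P2) set" where
  "twisted_group p S = twisted p S ` carrier (quasi_cyclic_group p)"

lemma twist_comp: "twist p S N z \<circ> twist p S N w = twist p S N (z * w)"
proof -
  have "twist p S N z \<circ> twist p S N w = shear (gap_poly p S N) \<circ> scale z
      \<circ> (shear (- gap_poly p S N) \<circ> shear (gap_poly p S N)) \<circ> scale w \<circ> shear (- gap_poly p S N)"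
    unfolding twist_def by (simp only: comp_assoc)
  then show ?thesis by (simp add: twist_def comp_assoc flip: scale_comp)
qed

lemma aut_twist: "z \<noteq> 0 \<Longrightarrow> P2_automorphism (twist p S N z)"
  by (simp add: twist_def aut_comp aut_shear aut_scale)

lemma twist_X1: "twist p S N z X1 = P2_const z * X1"
  by (simp add: twist_def scale_X1 aut_mult[OF aut_shear] aut_const[OF aut_shear])

text \<open>
  The terms of the gap series between the two levels have exponents \<open>e\<close> with \<open>z ^ e = z\<close>, so
  the shear that they define commutes with the scalar and cancels in the conjugation.
\<close>

lemma twist_stable:
  assumes "p > 0" "z ^ (p ^ N) = 1" "N \<le> M"
  shows "twist p S M z = twist p S N z"
proof -
  have z: "z \<noteq> 0"
    using assms(1,2) by (auto simp: power_0_left)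
  define r where "r = (\<Sum>n\<in>S \<inter> {N..<M}. monom (1::complex) (Suc (p ^ n)))"
  have "S \<inter> {..<M} = (S \<inter> {..<N}) \<union> (S \<inter> {N..<M})"
    using assms(3) by auto
  then have g: "gap_poly p S M = gap_poly p S N + r"
    unfolding gap_poly_def r_def by (simp add: sum.union_disjoint disjoint_iff)
  have "z ^ (p ^ n) = 1" if "N \<le> n" for n
  proof -
    have "p ^ n = p ^ N * p ^ (n - N)"
      using that by (simp flip: power_add)
    then show ?thesis using assms(2) by (simp add: power_mult)
  qed
  then have "r \<circ>\<^sub>p [:0, z:] = smult z r"
    unfolding r_def by (intro poly_eqI) (auto simp: coeff_pcompose_linear coeff_sum sum_distrib_left intro!: sum.cong)
  then have c: "scale z \<circ> shear r = shear r \<circ> scale z"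
    by (rule scale_shear_commute[OF z])
  have "shear (gap_poly p S M) = shear (gap_poly p S N) \<circ> shear r"
    "shear (- gap_poly p S M) = shear (- r) \<circ> shear (- gap_poly p S N)"
    by (simp_all add: g shear_comp algebra_simps)
  then have "twist p S M z = shear (gap_poly p S N) \<circ> (shear r \<circ> scale z) \<circ> shear (- r) \<circ> shear (- gap_poly p S N)"
    by (simp only: twist_def comp_assoc)
  also have "\<dots> = shear (gap_poly p S N) \<circ> scale z \<circ> (shear r \<circ> shear (- r)) \<circ> shear (- gap_poly p S N)"
    by (simp only: c[symmetric] comp_assoc)
  finally show ?thesis by (simp add: twist_def)
qed

lemma twisted_eq_twist:
  assumes "p > 0" "z ^ (p ^ N) = 1"
  shows "twisted p S z = twist p S N z"
  unfolding twisted_def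
  using twist_stable[OF assms(1) LeastI[of "\<lambda>N. z ^ (p ^ N) = 1", OF assms(2)] Least_le[of "\<lambda>N. z ^ (p ^ N) = 1", OF assms(2)]]
  by simp

lemma quasi_cyclic_common_level:
  assumes "z \<in> carrier (quasi_cyclic_group p)" "w \<in> carrier (quasi_cyclic_group p)"
  obtains N where "z ^ (p ^ N) = 1" "w ^ (p ^ N) = 1"
proof -
  obtain M N where "z ^ (p ^ M) = 1" "w ^ (p ^ N) = 1"
    using assms by (auto simp: quasi_cyclic_group_def)
  then have "z ^ (p ^ (M + N)) = 1" "w ^ (p ^ (N + M)) = 1"
    by (simp_all add: power_add power_mult)
  then show ?thesis using that[of "M + N"] by (simp add: add.commute)
qed

lemma quasi_cyclic_closed:
  assumes "p > 0"
  shows "z \<in> carrier (quasi_cyclic_group p) \<Longrightarrow> w \<in> carrier (quasi_cyclic_group p)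
      \<Longrightarrow> z * w \<in> carrier (quasi_cyclic_group p)"
    and "z \<in> carrier (quasi_cyclic_group p) \<Longrightarrow> inverse z \<in> carrier (quasi_cyclic_group p)"
    and "1 \<in> carrier (quasi_cyclic_group p)"
    and "z \<in> carrier (quasi_cyclic_group p) \<Longrightarrow> z \<noteq> 0"
proof -
  show "z * w \<in> carrier (quasi_cyclic_group p)"
    if zw: "z \<in> carrier (quasi_cyclic_group p)" "w \<in> carrier (quasi_cyclic_group p)"
  proof -
    obtain N where N: "z ^ (p ^ N) = 1" "w ^ (p ^ N) = 1"
      using quasi_cyclic_common_level[OF zw] .
    \<comment> \<open>The exponent of \<open>p\<close> must be positive in the definition of the quasi-cyclic group.\<close>
    then have "(z * w) ^ (p ^ Suc N) = 1"
      by (simp add: power_mult_distrib power_mult mult.commute[of p])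
    then show ?thesis unfolding quasi_cyclic_group_def by auto
  qed
qed (use assms in \<open>auto simp: quasi_cyclic_group_def power_inverse power_0_left\<close>)

lemma twisted_comp:
  assumes "p > 0" "z \<in> carrier (quasi_cyclic_group p)" "w \<in> carrier (quasi_cyclic_group p)"
  shows "twisted p S z \<circ> twisted p S w = twisted p S (z * w)"
proof -
  obtain N where N: "z ^ (p ^ N) = 1" "w ^ (p ^ N) = 1"
    using quasi_cyclic_common_level[OF assms(2,3)] .
  then have "(z * w) ^ (p ^ N) = 1"
    by (simp add: power_mult_distrib)
  then show ?thesis
    using N by (simp add: twisted_eq_twist[OF assms(1)] twist_comp)
qed

lemma twisted_1: "p > 0 \<Longrightarrow> twisted p S 1 = id"
  by (simp add: twisted_eq_twist[of p 1 0] twist_def)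

lemma aut_twisted:
  assumes "p > 0" "z \<in> carrier (quasi_cyclic_group p)"
  shows "P2_automorphism (twisted p S z)"
  using aut_twist quasi_cyclic_closed(4)[OF assms] by (simp add: twisted_def)

lemma twisted_X1: "twisted p S z X1 = P2_const z * X1"
  by (simp add: twisted_def twist_X1)

lemma subgroup_twisted_group:
  assumes "p > 0"
  shows "subgroup (twisted_group p S) Aut_P2"
proof (rule group.subgroupI[OF group_Aut_P2])
  show "twisted_group p S \<subseteq> carrier Aut_P2"
    using aut_twisted[OF assms] by (auto simp: twisted_group_def Aut_P2_def)
  show "twisted_group p S \<noteq> {}"
    using quasi_cyclic_closed(3)[OF assms] by (auto simp: twisted_group_def)
  show "inv\<^bsub>Aut_P2\<^esub> a \<in> twisted_group p S" if a: "a \<in> twisted_group p S" for a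
  proof -
    obtain z where z: "z \<in> carrier (quasi_cyclic_group p)" "a = twisted p S z"
      using a by (auto simp: twisted_group_def)
    note z' = quasi_cyclic_closed(2)[OF assms z(1)]
    have "twisted p S (inverse z) \<circ> a = id"
      using quasi_cyclic_closed(4)[OF assms z(1)]
      by (simp add: z twisted_comp[OF assms z' z(1)] twisted_1[OF assms])
    then have "inv\<^bsub>Aut_P2\<^esub> a = twisted p S (inverse z)"
      using aut_twisted[OF assms] z z'
      by (intro group.inv_equality[OF group_Aut_P2]) (auto simp: Aut_P2_def)
    then show ?thesis using z' by (simp add: twisted_group_def)
  qed
  show "a \<otimes>\<^bsub>Aut_P2\<^esub> b \<in> twisted_group p S" if "a \<in> twisted_group p S" "b \<in> twisted_group p S" for a b
    using that twisted_comp[OF assms] quasi_cyclic_closed(1)[OF assms]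
    by (auto simp: twisted_group_def Aut_P2_def)
qed

text \<open>
  The inverse of \<open>z \<mapsto> twisted p S z\<close> reads off \<open>z\<close> as the eigenvalue on \<open>x\<^sub>1\<close>.
\<close>

lemma twisted_group_iso:
  assumes "p > 0"
  shows "Aut_P2\<lparr>carrier := twisted_group p S\<rparr> \<cong> quasi_cyclic_group p"
proof -
  have ev: "cf (twisted p S z X1) 1 0 = z" for z
    by (simp add: twisted_X1)
  have "(\<lambda>\<phi>. cf (\<phi> X1) 1 0) \<in> iso (Aut_P2\<lparr>carrier := twisted_group p S\<rparr>) (quasi_cyclic_group p)"
  proof (rule isoI)
    have "cf ((twisted p S z \<circ> twisted p S w) X1) 1 0 = z * w"
      if "z \<in> carrier (quasi_cyclic_group p)" "w \<in> carrier (quasi_cyclic_group p)" for z w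
      unfolding twisted_comp[OF assms that] by (rule ev)
    then show "(\<lambda>\<phi>. cf (\<phi> X1) 1 0) \<in> hom (Aut_P2\<lparr>carrier := twisted_group p S\<rparr>) (quasi_cyclic_group p)"
      unfolding hom_def twisted_group_def Pi_def using ev
      by (auto simp: Aut_P2_def) (auto simp: quasi_cyclic_group_def)
    show "bij_betw (\<lambda>\<phi>. cf (\<phi> X1) 1 0) (carrier (Aut_P2\<lparr>carrier := twisted_group p S\<rparr>)) (carrier (quasi_cyclic_group p))"
      using ev by (intro bij_betw_byWitness[where f' = "twisted p S"]) (auto simp: twisted_group_def)
  qed
  then show ?thesis by (auto simp: is_iso_def)
qed

section \<open>Automorphisms that conjugate twisted groups\<close>

lemma primitive_root_of_unity:
  assumes "n > 0"
  obtains z :: complex where "z ^ n = 1" "\<And>k. 0 < k \<Longrightarrow> k < n \<Longrightarrow> z ^ k \<noteq> 1"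
proof
  let ?z = "cis (2 * pi / real n)"
  show "?z ^ n = 1" using assms by (simp add: DeMoivre)
  fix k assume k: "0 < k" "k < n"
  have "inj_on (\<lambda>k. cis (2 * pi * real k / real n)) {..<n}"
    using bij_betw_roots_unity[OF assms] by (simp add: bij_betw_def)
  from inj_onD[OF this, of k 0] k show "?z ^ k \<noteq> 1"
    by (auto simp: DeMoivre mult_ac)
qed

text \<open>
  A property common to the elements of \<open>twisted_group p S\<close> and, for \<open>S = {}\<close>, to linear
  automorphisms. It allows one argument to exclude conjugacy to another twisted group and to a
  linear group.
\<close>

definition linear_up_to_gaps :: "nat \<Rightarrow> nat set \<Rightarrow> (P2 \<Rightarrow> P2) \<Rightarrow> bool" where
  "linear_up_to_gaps p S k \<longleftrightarrow> (\<exists>N\<^sub>0. \<forall>N\<ge>N\<^sub>0. \<exists>l\<in>linear_Aut_P2.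
     k = shear (gap_poly p S N) \<circ> l \<circ> shear (- gap_poly p S N))"

text \<open>
  Up to high order, \<open>\<phi>\<close> is a linear map, with matrix entries \<open>a\<close>, \<open>b\<close>, \<open>c\<close>, \<open>d\<close>, between the
  shears for \<open>T\<close> and \<open>S\<close>. To see this, let \<open>\<psi>\<close> be \<open>\<phi>\<close> with both shears removed and \<open>z\<close> a primitive
  root of unity of order \<open>p ^ N\<close>. The scalar \<open>z\<close> is conjugate under \<open>\<psi>\<close> to a linear automorphism,
  which must be \<open>z\<close> itself; so \<open>\<psi>\<close> commutes with \<open>z\<close> and has no terms of degrees between \<open>2\<close>
  and \<open>p ^ N\<close>.
\<close>

lemma conjugator_mod_high_order:
  assumes p: "p \<ge> 2" and \<phi>: "P2_automorphism \<phi>"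
    and conj: "\<And>h. h \<in> twisted_group p T \<Longrightarrow> \<exists>k. h \<circ> \<phi> = \<phi> \<circ> k \<and> linear_up_to_gaps p S k"
    and N: "N > 0"
  obtains M a b c d where "M \<ge> N"
    "order_ge (Suc (p ^ N)) (\<phi> X1 - (P2_const d * X1 + P2_const c * (X2 + [:gap_poly p T M:])))"
    "order_ge (Suc (p ^ N)) (\<phi> X2 + \<phi> [:gap_poly p S M:]
       - (P2_const b * X1 + P2_const a * (X2 + [:gap_poly p T M:])))"
    "d * a - c * b \<noteq> 0"
proof -
  have p0: "p > 0" using p by simp
  have pN: "p ^ N \<ge> 2"
    using p N self_le_power[of p N] by linarith
  obtain z :: complex where z: "z ^ (p ^ N) = 1" and prim: "\<And>k. 0 < k \<Longrightarrow> k < p ^ N \<Longrightarrow> z ^ k \<noteq> 1"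
    using primitive_root_of_unity[of "p ^ N"] p0 by auto
  have z0: "z \<noteq> 0" using z p0 by (auto simp: power_0_left)
  have z1: "z \<noteq> 1" using prim[of 1] pN by auto
  have "z \<in> carrier (quasi_cyclic_group p)"
    using z N by (auto simp: quasi_cyclic_group_def intro: Suc_leI)
  then obtain k where k: "twisted p T z \<circ> \<phi> = \<phi> \<circ> k" "linear_up_to_gaps p S k"
    using conj[of "twisted p T z"] by (auto simp: twisted_group_def)
  obtain N\<^sub>0 where N0: "\<forall>N\<ge>N\<^sub>0. \<exists>l\<in>linear_Aut_P2.
     k = shear (gap_poly p S N) \<circ> l \<circ> shear (- gap_poly p S N)"
    using k(2) by (auto simp: linear_up_to_gaps_def)
  \<comment> \<open>This level is high enough both for the truncation for \<open>T\<close> to represent the element \<open>z\<close> and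
    for \<open>k\<close> to be linear once the shear for \<open>S\<close> is removed.\<close>
  define M where "M = max N N\<^sub>0"
  obtain l where l: "l \<in> linear_Aut_P2"
      "k = shear (gap_poly p S M) \<circ> l \<circ> shear (- gap_poly p S M)"
    using N0 unfolding M_def by (meson max.cobounded2)
  define s where "s = gap_poly p S M"
  define t where "t = gap_poly p T M"
  have inv: "shear h (shear (- h) f) = f" "shear (- h) (shear h f) = f" for h f
    using fun_cong[OF shear_uminus(1), of h f] fun_cong[OF shear_uminus(2), of h f]
    by (simp_all only: comp_apply id_apply)
  have "twisted p T z = twist p T M z"
    using twisted_eq_twist[OF p0 z] twist_stable[OF p0 z, of M] by (simp add: M_def)
  then have tw: "shear t (scale z (shear (- t) (\<phi> f))) = \<phi> (shear s (l (shear (- s) f)))" for f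
    using fun_cong[OF k(1), of f] by (simp add: l twist_def s_def t_def)
  obtain \<phi>' where \<phi>': "P2_automorphism \<phi>'" "\<phi> \<circ> \<phi>' = id" "\<phi>' \<circ> \<phi> = id"
    using aut_inverse_exists[OF \<phi>] .
  have \<phi>\<phi>': "\<phi> (\<phi>' f) = f" "\<phi>' (\<phi> f) = f" for f
    using fun_cong[OF \<phi>'(2), of f] fun_cong[OF \<phi>'(3), of f] by simp_all
  define \<psi> where "\<psi> = shear (- t) \<circ> \<phi> \<circ> shear s"
  define \<theta> where "\<theta> = shear (- s) \<circ> \<phi>' \<circ> shear t"
  have aut: "P2_automorphism \<psi>" "P2_automorphism \<theta>"
    by (simp_all add: \<psi>_def \<theta>_def aut_comp aut_shear \<phi> \<phi>')
  have inverse: "\<psi> \<circ> \<theta> = id" "\<theta> \<circ> \<psi> = id"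
    by (simp_all add: \<psi>_def \<theta>_def fun_eq_iff inv \<phi>\<phi>')
  have \<psi>l: "scale z (\<psi> f) = \<psi> (l f)" for f
    using arg_cong[OF tw[of "shear s f"], of "shear (- t)"] by (simp add: \<psi>_def inv)
  have "l \<circ> \<theta> = \<theta> \<circ> scale z"
  proof
    fix f
    have "\<theta> (scale z (\<psi> (\<theta> f))) = \<theta> (\<psi> (l (\<theta> f)))" by (simp only: \<psi>l)
    then show "(l \<circ> \<theta>) f = (\<theta> \<circ> scale z) f"
      using fun_cong[OF inverse(1)] fun_cong[OF inverse(2)] by simp
  qed
  note lin = linear_conjugate_scale[OF aut(2,1) inverse(2) l(1) z0 z1 this]
  have o: "fixes_origin \<psi>"
    using aut_cf_0_0[OF aut(2) lin(2), of "\<psi> X1"] aut_cf_0_0[OF aut(2) lin(2), of "\<psi> X2"]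
      fun_cong[OF inverse(2)] by (simp add: fixes_origin_def)
  have eig: "scale z (\<psi> X1) = P2_const z * \<psi> X1" "scale z (\<psi> X2) = P2_const z * \<psi> X2"
    by (simp_all add: \<psi>l lin(1) scale_X1 scale_X2 aut_mult[OF aut(1)] aut_const[OF aut(1)])
  have near: "order_ge (Suc (p ^ N)) (\<psi> X1 - (P2_const (cf (\<psi> X1) 1 0) * X1 + P2_const (cf (\<psi> X1) 0 1) * X2))"
    "order_ge (Suc (p ^ N)) (\<psi> X2 - (P2_const (cf (\<psi> X2) 1 0) * X1 + P2_const (cf (\<psi> X2) 0 1) * X2))"
    using o scale_commuting_near_linear[OF eig(1) _ z0 prim] scale_commuting_near_linear[OF eig(2) _ z0 prim]
    by (simp_all add: fixes_origin_def)
  have t0: "fixes_origin (shear t)"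
    by (simp add: t_def fixes_origin_shear coeff_gap_poly_low p)
  have \<psi>X: "shear t (\<psi> X1) = \<phi> X1" "shear t (\<psi> X2) = \<phi> X2 + \<phi> [:s:]"
    by (simp_all add: \<psi>_def inv aut_add[OF \<phi>])
  show ?thesis
  proof (rule that)
    show "M \<ge> N" by (simp add: M_def)
  qed (use aut_near_linear[OF aut_shear t0 near(1), unfolded \<psi>X]
      aut_near_linear[OF aut_shear t0 near(2), unfolded \<psi>X]
      aut_jacobian_nonzero[OF aut inverse(1) o] in \<open>simp_all add: s_def t_def\<close>)
qed

text \<open>
  The coefficients of \<open>\<phi> X1\<close> and \<open>\<phi> X2\<close> at the powers \<open>x\<^sub>1 ^ (1 + p ^ n)\<close> record, for
  all \<open>n\<close>, the membership of \<open>n\<close> in \<open>S\<close> and \<open>T\<close>. As only finitely many of them are nonzero,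
  first \<open>c = 0\<close>, and then \<open>S\<close> and \<open>T\<close> are equal up to finitely many elements.
\<close>

theorem conjugate_gap_sets:
  assumes p: "p \<ge> 2" and \<phi>: "P2_automorphism \<phi>"
    and conj: "\<And>h. h \<in> twisted_group p T \<Longrightarrow> \<exists>k. h \<circ> \<phi> = \<phi> \<circ> k \<and> linear_up_to_gaps p S k"
    and T: "infinite T"
  shows "finite {n. n \<in> S \<longleftrightarrow> n \<notin> T}"
proof -
  define d c where "d = cf (\<phi> X1) 1 0" and "c = cf (\<phi> X1) 0 1"
  \<comment> \<open>The gap polynomials have no terms of degree below 2, so \<open>c\<close> and \<open>d\<close> do not depend on \<open>N\<close>.\<close>
  have level: "\<exists>M\<ge>N. \<exists>a b.
    order_ge (Suc (p ^ N)) (\<phi> X1 - (P2_const d * X1 + P2_const c * (X2 + [:gap_poly p T M:])))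
    \<and> order_ge (Suc (p ^ N)) (\<phi> X2 + \<phi> [:gap_poly p S M:]
       - (P2_const b * X1 + P2_const a * (X2 + [:gap_poly p T M:])))
    \<and> d * a - c * b \<noteq> 0" if "N > 0" for N
  proof -
    obtain M a b c' d' where *: "M \<ge> N"
    "order_ge (Suc (p ^ N)) (\<phi> X1 - (P2_const d' * X1 + P2_const c' * (X2 + [:gap_poly p T M:])))"
    "order_ge (Suc (p ^ N)) (\<phi> X2 + \<phi> [:gap_poly p S M:]
       - (P2_const b * X1 + P2_const a * (X2 + [:gap_poly p T M:])))"
    "d' * a - c' * b \<noteq> 0"
      using conjugator_mod_high_order[OF p \<phi> conj \<open>N > 0\<close>] by metis
    have "cf (\<phi> X1 - (P2_const d' * X1 + P2_const c' * (X2 + [:gap_poly p T M:]))) i j = 0"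
      if "i + j = 1" for i j
      using *(2) p that unfolding order_ge_def by (simp del: cf_diff)
    from this[of 1 0] this[of 0 1] have "d = d'" "c = c'"
      using p by (simp_all add: d_def c_def coeff_gap_poly_low)
    then show ?thesis using * by blast
  qed
  have pow_less: "Suc (p ^ n) < Suc (p ^ Suc n)" for n
    using p by simp
  \<comment> \<open>Otherwise \<open>\<phi> X1\<close> would have the coefficient \<open>c\<close> at \<open>x\<^sub>1 ^ (1 + p ^ n)\<close> for every \<open>n\<close> in the
    infinite set \<open>T\<close>.\<close>
  have c0: "c = 0"
  proof (rule ccontr)
    assume "c \<noteq> 0"
    have "cf (\<phi> X1) (Suc (p ^ n)) 0 = c" if "n \<in> T" for n
    proof -
      obtain M where M: "M \<ge> Suc n" "order_ge (Suc (p ^ Suc n))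
          (\<phi> X1 - (P2_const d * X1 + P2_const c * (X2 + [:gap_poly p T M:])))"
        using level[of "Suc n"] by auto
      then have "cf (\<phi> X1 - (P2_const d * X1 + P2_const c * (X2 + [:gap_poly p T M:]))) (Suc (p ^ n)) 0 = 0"
        unfolding order_ge_def using pow_less[of n] by simp
      then show ?thesis
        using M(1) that p by (simp add: coeff_gap_poly_exponent)
    qed
    then have "T \<subseteq> {n. cf (\<phi> X1) (Suc (p ^ n)) 0 \<noteq> 0}"
      using \<open>c \<noteq> 0\<close> by auto
    then show False
      using T finite_gap_coefficients[OF p] finite_subset by blast
  qed
  \<comment> \<open>With \<open>c = 0\<close> the approximation of \<open>\<phi> X1\<close> no longer depends on the level, and it holds to
    arbitrarily high order.\<close>
  have X1: "\<phi> X1 = P2_const d * X1"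
  proof (rule P2_eqI)
    fix i j
    have "i + j < Suc (p ^ Suc (i + j))"
      using power_gt_expt[of p "Suc (i + j)"] p by simp
    then show "cf (\<phi> X1) i j = cf (P2_const d * X1) i j"
      using level[of "Suc (i + j)"] by (auto simp: c0 order_ge_def)
  qed
  define a where "a = cf (\<phi> X2) 0 1"
  have coeffs: "cf (\<phi> X2) (Suc (p ^ n)) 0 + d ^ Suc (p ^ n) * of_bool (n \<in> S) = a * of_bool (n \<in> T)
      \<and> d * a \<noteq> 0" for n
  proof -
    obtain M a' b where M: "M \<ge> Suc n" "order_ge (Suc (p ^ Suc n)) (\<phi> X2 + \<phi> [:gap_poly p S M:]
       - (P2_const b * X1 + P2_const a' * (X2 + [:gap_poly p T M:])))" "d * a' \<noteq> 0"
      using level[of "Suc n"] c0 by auto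
    let ?D = "\<phi> X2 + \<phi> [:gap_poly p S M:] - (P2_const b * X1 + P2_const a' * (X2 + [:gap_poly p T M:]))"
    have "0 + 1 < Suc (p ^ Suc n)" using p by simp
    then have "cf ?D 0 1 = 0" "cf ?D (Suc (p ^ n)) 0 = 0"
      using M(2) pow_less[of n] unfolding order_ge_def by (simp_all del: cf_diff cf_add)
    then show ?thesis
      using M p by (simp add: aut_inner[OF \<phi> X1] coeff_pcompose_linear coeff_gap_poly_exponent a_def)
  qed
  have "{n. n \<in> S \<longleftrightarrow> n \<notin> T} \<subseteq> {n. cf (\<phi> X2) (Suc (p ^ n)) 0 \<noteq> 0}"
  proof clarify
    fix n assume "n \<in> S \<longleftrightarrow> n \<notin> T" "cf (\<phi> X2) (Suc (p ^ n)) 0 = 0"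
    then show False using coeffs[of n] by (cases "n \<in> S") auto
  qed
  then show ?thesis
    using finite_gap_coefficients[OF p] finite_subset by blast
qed

lemma linear_up_to_gaps_twisted:
  assumes "p > 0" "k \<in> twisted_group p S"
  shows "linear_up_to_gaps p S k"
proof -
  obtain z N where z: "k = twisted p S z" "z ^ (p ^ N) = 1" "z \<in> carrier (quasi_cyclic_group p)"
    using assms(2) by (auto simp: twisted_group_def quasi_cyclic_group_def)
  have "P2_linear_form (P2_const z * X1)" "P2_linear_form (P2_const z * X2)"
    unfolding P2_linear_form_def
    by (rule exI[of _ z], rule exI[of _ 0], simp) (rule exI[of _ 0], rule exI[of _ z], simp)
  then have "scale z \<in> linear_Aut_P2"
    using aut_scale[OF quasi_cyclic_closed(4)[OF assms(1) z(3)]]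
    by (simp add: linear_Aut_P2_def Aut_P2_def scale_X1 scale_X2)
  moreover have "k = twist p S M z" if "M \<ge> N" for M
    using twisted_eq_twist[OF assms(1) z(2)] twist_stable[OF assms(1) z(2) that] z(1) by simp
  ultimately show ?thesis
    unfolding linear_up_to_gaps_def twist_def by blast
qed

lemma linear_up_to_no_gaps: "l \<in> linear_Aut_P2 \<Longrightarrow> linear_up_to_gaps p {} l"
  by (auto simp: linear_up_to_gaps_def gap_poly_def)

lemma not_conjugate_twisted_groups:
  assumes "p \<ge> 2" "infinite T" "infinite {n. n \<in> S \<longleftrightarrow> n \<notin> T}"
  shows "\<not> conjugate_in Aut_P2 (twisted_group p S) (twisted_group p T)"
proof
  assume "conjugate_in Aut_P2 (twisted_group p S) (twisted_group p T)"
  then obtain \<phi> \<psi> where \<phi>: "P2_automorphism \<phi>" "\<psi> \<circ> \<phi> = id"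
    "twisted_group p T = (\<lambda>h. \<phi> \<circ> h \<circ> \<psi>) ` twisted_group p S"
    by (rule conjugate_in_Aut_P2)
  have "\<exists>k. h \<circ> \<phi> = \<phi> \<circ> k \<and> linear_up_to_gaps p S k" if "h \<in> twisted_group p T" for h
  proof -
    obtain k where k: "k \<in> twisted_group p S" "h = \<phi> \<circ> k \<circ> \<psi>"
      using \<open>h \<in> twisted_group p T\<close> \<phi>(3) by auto
    then have "h \<circ> \<phi> = \<phi> \<circ> k"
      by (simp add: comp_assoc \<phi>(2))
    then show ?thesis
      using k(1) linear_up_to_gaps_twisted assms(1) by auto
  qed
  then show False
    using conjugate_gap_sets[OF assms(1) \<phi>(1)] assms(2,3) by blast
qed

lemma not_conjugate_to_linear:
  assumes "p \<ge> 2" "infinite T" "L \<subseteq> linear_Aut_P2"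
  shows "\<not> conjugate_in Aut_P2 (twisted_group p T) L"
proof
  assume "conjugate_in Aut_P2 (twisted_group p T) L"
  then obtain \<phi> \<psi> where \<phi>: "P2_automorphism \<psi>" "\<psi> \<circ> \<phi> = id"
    "L = (\<lambda>h. \<phi> \<circ> h \<circ> \<psi>) ` twisted_group p T"
    by (rule conjugate_in_Aut_P2)
  have "\<exists>k. h \<circ> \<psi> = \<psi> \<circ> k \<and> linear_up_to_gaps p {} k" if "h \<in> twisted_group p T" for h
  proof (intro exI conjI)
    show "h \<circ> \<psi> = \<psi> \<circ> (\<phi> \<circ> h \<circ> \<psi>)"
      using \<phi>(2) by (simp flip: comp_assoc)
    show "linear_up_to_gaps p {} (\<phi> \<circ> h \<circ> \<psi>)"
      using that \<phi>(3) assms(3) by (intro linear_up_to_no_gaps) auto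
  qed
  then have "finite {n. n \<in> {} \<longleftrightarrow> n \<notin> T}"
    by (rule conjugate_gap_sets[OF assms(1) \<phi>(1) _ assms(2)])
  then show False using assms(2) by simp
qed

section \<open>An uncountable family\<close>

lemma uncountable_nonempty_nat_sets: "uncountable {A :: nat set. A \<noteq> {}}"
proof
  assume "countable {A :: nat set. A \<noteq> {}}"
  then have "countable (insert {} {A :: nat set. A \<noteq> {}})" by simp
  moreover have "insert {} {A :: nat set. A \<noteq> {}} = UNIV" by auto
  ultimately obtain f :: "nat \<Rightarrow> nat set" where "range f = UNIV"
    using uncountable_def by (metis UNIV_not_empty)
  then have "{n. n \<notin> f n} \<in> range f" by simp
  then show False by auto
qed

text \<open>
  Every element is repeated infinitely often, so that distinct sets acquire an infinite
  symmetric difference.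
\<close>

definition spread :: "nat set \<Rightarrow> nat set" where
  "spread A = prod_encode ` (A \<times> UNIV)"

lemma prod_encode_in_spread [simp]: "prod_encode (i, j) \<in> spread A \<longleftrightarrow> i \<in> A"
  by (auto simp: spread_def)

lemma infinite_prod_encode_fibre: "infinite (range (\<lambda>j. prod_encode (i, j)))"
  by (rule range_inj_infinite) (simp add: inj_on_def)

lemma infinite_spread: "A \<noteq> {} \<Longrightarrow> infinite (spread A)"
proof -
  assume "A \<noteq> {}"
  then obtain i where "i \<in> A" by auto
  then have "range (\<lambda>j. prod_encode (i, j)) \<subseteq> spread A" by auto
  then show ?thesis
    using infinite_prod_encode_fibre infinite_super by blast
qed

lemma infinite_spread_difference:
  assumes "A \<noteq> B"
  shows "infinite {n. n \<in> spread A \<longleftrightarrow> n \<notin> spread B}"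
proof -
  obtain i where "i \<in> A \<longleftrightarrow> i \<notin> B" using assms by auto
  then have "range (\<lambda>j. prod_encode (i, j)) \<subseteq> {n. n \<in> spread A \<longleftrightarrow> n \<notin> spread B}"
    by auto
  then show ?thesis
    using infinite_prod_encode_fibre infinite_super by blast
qed

theorem theorem0p1:
  fixes p :: nat
  assumes "prime p"
  shows "\<exists>\<S>. uncountable \<S> \<and>
           (\<forall>H\<in>\<S>. subgroup H Aut_P2) \<and>
           (\<forall>H\<in>\<S>. \<forall>K\<in>\<S>. H \<noteq> K \<longrightarrow> \<not> conjugate_in Aut_P2 H K) \<and>
           (\<forall>H\<in>\<S>. Aut_P2\<lparr>carrier := H\<rparr> \<cong> quasi_cyclic_group p) \<and>
           (\<forall>H\<in>\<S>. \<not> (\<exists>L. subgroup L Aut_P2 \<and> L \<subseteq> linear_Aut_P2 \<and> conjugate_in Aut_P2 H L))"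
proof -
  have p: "p \<ge> 2" "p > 0"
    using assms prime_ge_2_nat prime_gt_0_nat by auto
  let ?H = "\<lambda>A. twisted_group p (spread A)"
  have nonconj: "\<not> conjugate_in Aut_P2 (?H A) (?H B)" if "B \<noteq> {}" "A \<noteq> B" for A B
    using that p by (intro not_conjugate_twisted_groups infinite_spread infinite_spread_difference)
  have refl: "conjugate_in Aut_P2 (?H A) (?H A)" for A
  proof -
    interpret G: group Aut_P2 by (rule group_Aut_P2)
    have "?H A \<subseteq> carrier Aut_P2"
      using subgroup.subset[OF subgroup_twisted_group[OF p(2)]] .
    then show ?thesis
      unfolding conjugate_in_def
      by (intro bexI[of _ "\<one>\<^bsub>Aut_P2\<^esub>"]) (simp_all add: G.lcos_mult_one G.coset_mult_one)
  qed
  \<comment> \<open>Each group is conjugate to itself, so the groups of distinct sets are distinct.\<close>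
  have "inj_on ?H {A. A \<noteq> {}}"
  proof (rule inj_onI)
    fix A B assume "B \<in> {A. A \<noteq> {}}" "?H A = ?H B"
    then show "A = B" using nonconj[of B A] refl[of B] by auto
  qed
  then have "uncountable (?H ` {A. A \<noteq> {}})"
    using uncountable_nonempty_nat_sets countable_image_inj_on by blast
  moreover have "\<not> conjugate_in Aut_P2 H K"
    if "H \<in> ?H ` {A. A \<noteq> {}}" "K \<in> ?H ` {A. A \<noteq> {}}" "H \<noteq> K" for H K
  proof -
    obtain A B where "H = ?H A" "K = ?H B" "B \<noteq> {}"
      using \<open>H \<in> _\<close> \<open>K \<in> _\<close> by auto
    then show ?thesis using nonconj[of B A] \<open>H \<noteq> K\<close> by auto
  qed
  moreover have "\<not> (\<exists>L. subgroup L Aut_P2 \<and> L \<subseteq> linear_Aut_P2 \<and> conjugate_in Aut_P2 H L)"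
    if H: "H \<in> ?H ` {A. A \<noteq> {}}" for H
  proof -
    obtain A where "H = ?H A" "A \<noteq> {}"
      using H by auto
    then show ?thesis
      using not_conjugate_to_linear[OF p(1) infinite_spread] by auto
  qed
  moreover have "subgroup H Aut_P2" "Aut_P2\<lparr>carrier := H\<rparr> \<cong> quasi_cyclic_group p"
    if "H \<in> ?H ` {A. A \<noteq> {}}" for H
    using that subgroup_twisted_group[OF p(2)] twisted_group_iso[OF p(2)] by auto
  ultimately show ?thesis
    by (intro exI[of _ "?H ` {A. A \<noteq> {}}"] conjI ballI impI)
qed

end
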